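(* Let $n \ge k \ge 2$ be integers with $k \equiv 2$ or $3 \pmod 4$. Then \[ \mathbb{P}\big( G \sim \mathbb{G}(n,1/2) \text{ is a } k\text{-Ramsey graph} \big) = (-1)^{\binom{n}{k}} \cdot P_{n,k}\!\left(\tfrac12\right). \]
   Context: $[n]=\{1,\dots,n\}$; $\binom{S}{j}$ is the set of $j$-element subsets of $S$. $\mathbb{G}(n,1/2)$ is the Erdős–Rényi random graph on vertex set $[n]$ with edge probability $1/2$ (i.e. a uniformly random graph on $[n]$). A graph is $k$-Ramsey if it contains no clique of size $k$ and no independent set of size $k$. Let $\mathcal{A}$ be the set of assignments $\mathfrak{g}$ which associate to each $S \in \binom{[n]}{k}$ a finite simple undirected graph $\mathfrak{g}_S$ on vertex set $S$ which is neither the complete graph $K_S$ nor the empty graph $\overline{K_S}$. For $\mathfrak{g}\in\mathcal{A}$, let $\mathrm{Edges}(\mathfrak{g}) := \bigcup_{S} \mathbf{E}(\mathfrak{g}_S) \subseteq \binom{[n]}{2}$ and $\mathrm{sign}(\mathfrak{g}) := \prod_{S} (-1)^{|\mathbf{E}(\mathfrak{g}_S)|}$. Define $P_{n,k}(t) := \sum_{\mathfrak{g}\in\mathcal{A}} \mathrm{sign}(\mathfrak{g})\, t^{|\mathrm{Edges}(\mathfrak{g})|} \in \mathbb{Z}[t]$. *)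

theory Defs
  imports
    "HOL-Library.Ramsey"
    "HOL-Computational_Algebra.Polynomial"
    "HOL-Probability.Probability"
    "HOL-Probability.Product_PMF"
begin

text \<open>
  A simple undirected graph on a fixed vertex set \<open>V\<close> is identified with its edge set, a
  subset of \<open>[V]\<^bsup>2\<^esup>\<close>; the complete graph on \<open>V\<close> is \<open>[V]\<^bsup>2\<^esup>\<close>, the empty graph is \<open>{}\<close>.
\<close>

definition simple_graphs :: "'a set \<Rightarrow> 'a set set set" where
  "simple_graphs V = Pow ([V]\<^bsup>2\<^esup>)"

definition random_graph :: "nat \<Rightarrow> real \<Rightarrow> nat set set pmf" where
  "random_graph n p =
     map_pmf (\<lambda>b. {e \<in> [{1..n}]\<^bsup>2\<^esup>. b e})
       (Pi_pmf ([{1..n}]\<^bsup>2\<^esup>) False (\<lambda>_. bernoulli_pmf p))"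

lemma random_graph_half: "random_graph n (1/2) = pmf_of_set (simple_graphs {1..n})"
  unfolding random_graph_def simple_graphs_def
  by (intro pmf_of_set_Pow_conv_bernoulli finite_imp_finite_nsets) simp

definition ramsey_graph :: "nat \<Rightarrow> 'a set \<Rightarrow> 'a set set \<Rightarrow> bool" where
  "ramsey_graph k V E \<longleftrightarrow>
     \<not> (\<exists>S \<in> [V]\<^bsup>k\<^esup>. clique S E) \<and> \<not> (\<exists>S \<in> [V]\<^bsup>k\<^esup>. indep S E)"

text \<open>
  Assignments are taken extensional, so that each assignment on \<open>[{1..n}]\<^bsup>k\<^esup>\<close> is represented by
  exactly one function.
\<close>

definition assignments :: "nat \<Rightarrow> nat \<Rightarrow> (nat set \<Rightarrow> nat set set) set" where
  "assignments n k = (\<Pi>\<^sub>E S \<in> [{1..n}]\<^bsup>k\<^esup>. simple_graphs S - {[S]\<^bsup>2\<^esup>, {}})"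

definition Edges :: "nat \<Rightarrow> nat \<Rightarrow> (nat set \<Rightarrow> nat set set) \<Rightarrow> nat set set" where
  "Edges n k g = (\<Union>S \<in> [{1..n}]\<^bsup>k\<^esup>. g S)"

definition assignment_sign :: "nat \<Rightarrow> nat \<Rightarrow> (nat set \<Rightarrow> nat set set) \<Rightarrow> int" where
  "assignment_sign n k g = (\<Prod>S \<in> [{1..n}]\<^bsup>k\<^esup>. (-1) ^ card (g S))"

definition P_poly :: "nat \<Rightarrow> nat \<Rightarrow> int poly" where
  "P_poly n k = (\<Sum>g \<in> assignments n k. monom (assignment_sign n k g) (card (Edges n k g)))"

end

theory Submission
  imports Defs
begin

text \<open>
  Fix a graph \<open>G\<close> and a \<open>k\<close>-set \<open>S\<close>. Summing \<open>(-1)\<^bsup>|H|\<^esup>\<close> over all graphs \<open>H \<subseteq> G\<close> on \<open>S\<close> gives the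
  indicator that \<open>S\<close> is independent in \<open>G\<close>. Leaving out the empty graph subtracts \<open>1\<close>; leaving out
  the complete graph adds the indicator that \<open>S\<close> is a clique, because the congruence condition on
  \<open>k\<close> says exactly that \<open>k choose 2\<close> is odd. Hence the restricted sum is \<open>0\<close> if \<open>S\<close> is homogeneous
  and \<open>-1\<close> otherwise. Multiplying over all \<open>S\<close> and averaging over \<open>G\<close> gives the theorem, since a
  fixed edge set \<open>F\<close> is contained in the random graph with probability \<open>2\<^bsup>-|F|\<^esup>\<close>.
\<close>

text \<open>Expanding the product of \<open>-1 + 1\<close> over \<open>A\<close> means choosing
  \<open>-1\<close> on a subset \<open>X\<close> and \<open>1\<close> elsewhere, which yields the
  alternating sum.\<close>

lemma sum_Pow_neg_one_power_card:
  assumes "finite A"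
  shows "(\<Sum>X\<in>Pow A. (-1) ^ card X) = (of_bool (A = {}) :: 'a :: comm_ring_1)"
proof -
  have "(\<Sum>X\<in>Pow A. (-1) ^ card X) = (\<Prod>x\<in>A. -1 + 1 :: 'a)"
    using assms by (subst prod_add) auto
  also have "\<dots> = of_bool (A = {})"
    using assms by (simp add: power_0_left)
  finally show ?thesis .
qed

lemma prod_of_bool:
  assumes "finite A"
  shows "(\<Prod>x\<in>A. of_bool (P x)) = (of_bool (\<forall>x\<in>A. P x) :: 'a :: comm_semiring_1)"
  using assms by (induction A rule: finite_induct) auto

lemma card_Pow_supersets:
  assumes "finite U" and "F \<subseteq> U"
  shows "card {G \<in> Pow U. F \<subseteq> G} = 2 ^ (card U - card F)"
proof -
  have "bij_betw (\<lambda>X. X \<union> F) (Pow (U - F)) {G \<in> Pow U. F \<subseteq> G}"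
    using assms(2) by (intro bij_betwI[where g = "\<lambda>G. G - F"]) auto
  then have "card {G \<in> Pow U. F \<subseteq> G} = card (Pow (U - F))"
    by (simp add: bij_betw_same_card)
  then show ?thesis
    using assms by (simp add: card_Pow card_Diff_subset finite_subset)
qed

lemma poly_map_poly_of_int_sum_monom:
  fixes x :: "'a :: comm_ring_1"
  shows "poly (map_poly of_int (\<Sum>i\<in>I. monom (c i) (d i))) x = (\<Sum>i\<in>I. of_int (c i) * x ^ d i)"
proof -
  have add: "map_poly of_int (p + q) = map_poly of_int p + (map_poly of_int q :: 'a poly)" for p q
    by (rule poly_eqI) (simp add: coeff_map_poly)
  show ?thesis
    by (induction I rule: infinite_finite_induct) (auto simp: add map_poly_monom poly_monom)
qed

lemma odd_choose_two_iff: "odd (k choose 2) \<longleftrightarrow> k mod 4 = 2 \<or> k mod 4 = 3"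
proof (induction k)
  case (Suc k)
  \<comment> \<open>By Pascal's rule the parity flips exactly when \<open>k\<close> is odd, which
    gives period 4.\<close>
  have "Suc k choose 2 = k + (k choose 2)"
    by (simp add: numeral_2_eq_2)
  with Suc.IH show ?case
    by simp presburger
qed (simp add: numeral_2_eq_2)

lemma clique_iff_nsets: "clique S G \<longleftrightarrow> [S]\<^bsup>2\<^esup> \<subseteq> G"
  by (auto simp: clique_def nsets_2_eq)

lemma indep_iff_nsets: "indep S G \<longleftrightarrow> [S]\<^bsup>2\<^esup> \<inter> G = {}"
  by (auto simp: indep_def nsets_2_eq)

lemma sum_proper_graphs:
  assumes "odd (card S choose 2)"
  shows "(\<Sum>H \<in> simple_graphs S - {[S]\<^bsup>2\<^esup>, {}}. (-1) ^ card H * of_bool (H \<subseteq> G))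
       = (- of_bool (\<not> clique S G \<and> \<not> indep S G) :: 'a :: comm_ring_1)"
proof -
  let ?K = "[S]\<^bsup>2\<^esup>" and ?f = "\<lambda>H. (-1) ^ card H * of_bool (H \<subseteq> G) :: 'a"
  have cardK: "odd (card ?K)"
    using assms by simp
  \<comment> \<open>Infinite sets have \<open>card\<close> 0, so odd cardinality yields finiteness
    as well as nonemptiness.\<close>
  then have K: "?K \<noteq> {}" "finite ?K"
    by (metis card.empty even_zero, metis card.infinite even_zero)
  have "sum ?f (Pow ?K) = (\<Sum>H\<in>Pow (?K \<inter> G). (-1) ^ card H)"
    using K(2) by (intro sum.mono_neutral_cong_right) auto
  also have "\<dots> = of_bool (indep S G)"
    using K(2) by (subst sum_Pow_neg_one_power_card) (auto simp: indep_iff_nsets)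
  finally have all: "sum ?f (Pow ?K) = of_bool (indep S G)" .
  have "sum ?f (Pow ?K - {?K, {}}) = sum ?f (Pow ?K) - sum ?f {?K, {}}"
    using K(2) by (intro sum_diff) auto
  also note all
  \<comment> \<open>As \<open>?K\<close> is nonempty, the two terms are distinct; the minus sign is
    the odd parity of \<open>card ?K\<close>.\<close>
  also have "sum ?f {?K, {}} = 1 - of_bool (clique S G)"
    using K cardK by (simp add: clique_iff_nsets del: card_nsets)
  \<comment> \<open>Since \<open>?K\<close> is nonempty, \<open>S\<close> cannot be both a clique
    and independent, so the value 1 never occurs.\<close>
  also have "of_bool (indep S G) - (1 - of_bool (clique S G))
      = (- of_bool (\<not> clique S G \<and> \<not> indep S G) :: 'a)"
    using K(1) by (auto simp: clique_iff_nsets indep_iff_nsets)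
  finally show ?thesis
    by (simp add: simple_graphs_def)
qed

lemma sum_assignments_contained:
  assumes "odd (k choose 2)"
  shows "(\<Sum>g\<in>assignments n k. of_int (assignment_sign n k g) * of_bool (Edges n k g \<subseteq> G))
       = ((-1) ^ (n choose k) * of_bool (ramsey_graph k {1..n} G) :: 'a :: comm_ring_1)"
proof -
  let ?N = "[{1..n}]\<^bsup>k\<^esup>"
  have finN: "finite ?N"
    by (simp add: finite_imp_finite_nsets)
  have "(\<Sum>g\<in>assignments n k. of_int (assignment_sign n k g) * of_bool (Edges n k g \<subseteq> G))
      = (\<Sum>g\<in>assignments n k. \<Prod>S\<in>?N. (-1) ^ card (g S) * of_bool (g S \<subseteq> G) :: 'a)"
    using finN by (intro sum.cong refl)
      (simp add: assignment_sign_def Edges_def prod.distrib prod_of_bool UN_subset_iff)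
  \<comment> \<open>Distributivity: an assignment is an independent choice of one summand
    \<open>H\<close> for each factor \<open>S\<close>.\<close>
  also have "\<dots> = (\<Prod>S\<in>?N. \<Sum>H\<in>simple_graphs S - {[S]\<^bsup>2\<^esup>, {}}. (-1) ^ card H * of_bool (H \<subseteq> G))"
    unfolding assignments_def using finN
    by (intro prod_sum_PiE[symmetric])
      (auto simp: simple_graphs_def nsets_def[of _ k] finite_imp_finite_nsets)
  also have "\<dots> = (\<Prod>S\<in>?N. - of_bool (\<not> clique S G \<and> \<not> indep S G))"
    using assms by (intro prod.cong refl sum_proper_graphs) (simp add: nsets_def)
  also have "\<dots> = (-1) ^ (n choose k) * of_bool (ramsey_graph k {1..n} G)"
    using finN by (simp add: prod_uminus prod_of_bool ramsey_graph_def ball_conj_distrib)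
  finally show ?thesis .
qed

lemma prob_random_graph_half_contains:
  assumes "F \<subseteq> [{1..n}]\<^bsup>2\<^esup>"
  shows "measure_pmf.prob (random_graph n (1/2)) {G. F \<subseteq> G} = (1/2) ^ card F"
proof -
  let ?U = "[{1..n}]\<^bsup>2\<^esup>"
  have fin: "finite ?U"
    by (simp add: finite_imp_finite_nsets)
  have "measure_pmf.prob (random_graph n (1/2)) {G. F \<subseteq> G}
      = real (card {G \<in> Pow ?U. F \<subseteq> G}) / 2 ^ card ?U"
    using fin by (simp add: random_graph_half simple_graphs_def measure_pmf_of_set card_Pow
        Int_def Pow_not_empty del: card_nsets)
  \<comment> \<open>The exponent \<open>card ?U - card F\<close> is a natural subtraction;
    \<open>card_mono\<close> ensures that it does not truncate.\<close>
  also have "\<dots> = (1/2) ^ card F"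
    unfolding card_Pow_supersets[OF fin assms] using card_mono[OF fin assms]
    by (simp add:  power_one_over field_simps
        del: card_nsets flip: power_add)
  finally show ?thesis .
qed

theorem theorem2p3:
  fixes n k :: nat
  assumes "n \<ge> k" and "k \<ge> 2" and "k mod 4 = 2 \<or> k mod 4 = 3"
  shows "measure_pmf.prob (random_graph n (1/2)) {G. ramsey_graph k {1..n} G}
         = (-1) ^ (n choose k) * poly (map_poly real_of_int (P_poly n k)) (1/2)"
proof -
  let ?p = "random_graph n (1/2)"
  have odd: "odd (k choose 2)"
    using assms(3) by (simp add: odd_choose_two_iff)
  have prob: "measure_pmf.prob ?p {G. Q G} = measure_pmf.expectation ?p (\<lambda>G. of_bool (Q G))" for Q
    by (subst Bochner_Integration.integral_cong[OF refl, where g = "indicator {G. Q G}"])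
      (auto simp: indicator_def)
  have integrable: "integrable (measure_pmf ?p) (\<lambda>G. of_bool (Q G) :: real)" for Q
    by (rule measure_pmf.integrable_const_bound[where B = 1]) auto
  have Edges: "Edges n k g \<subseteq> [{1..n}]\<^bsup>2\<^esup>" if "g \<in> assignments n k" for g
  proof -
    have "g S \<subseteq> [{1..n}]\<^bsup>2\<^esup>" if "S \<in> [{1..n}]\<^bsup>k\<^esup>" for S
    proof -
      have "g S \<subseteq> [S]\<^bsup>2\<^esup>"
        using PiE_mem[OF \<open>g \<in> assignments n k\<close>[unfolded assignments_def] that]
        by (auto simp: simple_graphs_def)
      also have "\<dots> \<subseteq> [{1..n}]\<^bsup>2\<^esup>"
        using that by (intro nsets_mono) (auto simp: nsets_def)
      finally show ?thesis .
    qed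
    then show ?thesis
      by (auto simp: Edges_def)
  qed
  have "poly (map_poly real_of_int (P_poly n k)) (1/2)
      = (\<Sum>g\<in>assignments n k. of_int (assignment_sign n k g) * (1/2) ^ card (Edges n k g))"
    by (simp add: P_poly_def poly_map_poly_of_int_sum_monom)
  also have "\<dots> = (\<Sum>g\<in>assignments n k. of_int (assignment_sign n k g) *
      measure_pmf.expectation ?p (\<lambda>G. of_bool (Edges n k g \<subseteq> G)))"
    by (intro sum.cong refl) (simp only: Edges prob_random_graph_half_contains flip: prob)
  \<comment> \<open>Linearity of expectation, so that the sum over assignments can be evaluated for
    each fixed graph.\<close>
  also have "\<dots> = measure_pmf.expectation ?p
      (\<lambda>G. \<Sum>g\<in>assignments n k. of_int (assignment_sign n k g) * of_bool (Edges n k g \<subseteq> G))"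
    using integrable by (subst Bochner_Integration.integral_sum) auto
  also have "\<dots> = (-1) ^ (n choose k) * measure_pmf.prob ?p {G. ramsey_graph k {1..n} G}"
    by (simp add: sum_assignments_contained[OF odd] prob)
  finally show ?thesis
    \<comment> \<open>The sign squares to 1, so it may be moved to the other side.\<close>
    by (simp flip: mult.assoc power_mult_distrib)
qed

end
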